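(* Let $p$ be a prime, let $A$ and $B$ be non-empty subsets of $\mathbb{Z}/p\mathbb{Z}$, let $S \subseteq \mathbb{Z}/p\mathbb{Z}$, and let $$C=\{a+b:\ a\in A,\ b\in B,\ a-b\notin S\}.$$ Then $$|C|\geq \min\{p,\ |A|+|B|-2|S|-1\}.$$
   Context: Here $|X|$ denotes the cardinality of a finite set $X$. The quantity $|A|+|B|-2|S|-1$ is computed in the integers (it may be negative). *)

theory Defs
  imports Main "HOL-Number_Theory.Residues"
begin

text \<open>The ring of integers modulo \<open>n\<close>; its elements are the integers \<open>0, \<dots>, n - 1\<close>.\<close>

abbreviation ZMod :: "nat \<Rightarrow> int ring"
  where "ZMod n \<equiv> residue_ring (int n)"

definition restricted_sumset :: "('a, 'm) ring_scheme \<Rightarrow> 'a set \<Rightarrow> 'a set \<Rightarrow> 'a set \<Rightarrow> 'a set"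
  where "restricted_sumset R A B S =
    {a \<oplus>\<^bsub>R\<^esub> b | a b. a \<in> A \<and> b \<in> B \<and> a \<ominus>\<^bsub>R\<^esub> b \<notin> S}"

end

theory Submission
  imports Defs "HOL-Computational_Algebra.Polynomial"
begin

text \<open>Weights on \<open>A' \<subseteq> A\<close> and \<open>B' \<subseteq> B\<close> with \<open>|A'| = a + 1\<close>, \<open>|B'| = b + 1\<close>
  and \<open>a + b = |C| + 2|S|\<close> extract the coefficient of \<open>x\<^sup>a y\<^sup>b\<close> modulo \<open>p\<close> from a polynomial of
  degree at most \<open>a + b\<close>, so a polynomial vanishing on \<open>A' \<times> B'\<close> has that coefficient zero.
  Apply this to \<open>x\<^sup>j y\<^sup>k \<Prod>\<^sub>s (x - y - s) \<Prod>\<^sub>c (x + y - c)\<close>, where \<open>j + k = |S|\<close> is free: all coefficients of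
  \<open>(X - 1)^|S| (X + 1)^|C|\<close> with index in a window of length \<open>|S| + 1\<close> would vanish modulo \<open>p\<close>. That
  leaves at most \<open>|C|\<close> nonzero coefficients, whereas for \<open>m < p\<close> a polynomial with a zero of
  order exactly \<open>m\<close> at \<open>-1\<close> has more than \<open>m\<close> of them.\<close>

text \<open>Induction on \<open>m\<close>: one coefficient that is nonzero modulo \<open>p\<close>
  is killed at the cost of one order of vanishing at -1. Since \<open>m < p\<close>, the factors
  \<open>Suc m\<close> that appear are units modulo \<open>p\<close>.\<close>

lemma card_coeffs_not_dvd_gt:
  fixes p :: int and g :: "int poly"
  assumes "prime p" and "int m < p" and "\<not> p dvd poly g (- 1)"
  shows "m < card {i. \<not> p dvd coeff ([:1, 1:] ^ m * g) i}"
  using assms(2,3)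
proof (induction m arbitrary: g)
  case 0
  have "\<exists>i. \<not> p dvd coeff g i"
  proof (rule ccontr)
    assume "\<not> ?thesis"
    then have "p dvd poly g (- 1)"
      by (auto simp: poly_altdef intro!: dvd_sum)
    with 0 show False by simp
  qed
  moreover have "finite {i. \<not> p dvd coeff g i}"
    by (rule finite_subset[of _ "{..degree g}"]) (auto intro: le_degree)
  ultimately show ?case
    by (auto simp: card_gt_0_iff)
next
  case (Suc m)
  define F where "F = [:1, 1:] ^ Suc m * g"
  define N where "N = {i. \<not> p dvd coeff F i}"
  have finN: "finite N"
    unfolding N_def by (rule finite_subset[of _ "{..degree F}"]) (auto intro: le_degree)
  \<comment> \<open>The operator \<open>X d/dX - e\<close> kills the coefficient of index \<open>e\<close> and lowers the order
    of vanishing at \<open>-1\<close> by exactly one.\<close>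
  have step: "m < card (N - {e})" for e
  proof -
    \<comment> \<open>\<open>h\<close> is the cofactor left when \<open>(X + 1)^m\<close> is taken
      out of \<open>X F' - e F\<close>; at -1 only its first summand survives.\<close>
    define h where "h = smult (int (Suc m)) (pCons 0 g) + [:1, 1:] * (pCons 0 (pderiv g) - smult (int e) g)"
    have "poly h (- 1) = - (int (Suc m) * poly g (- 1))"
      by (simp add: h_def)
    moreover have "\<not> p dvd int (Suc m)"
      using Suc.prems(1) by (auto dest: zdvd_imp_le)
    ultimately have "\<not> p dvd poly h (- 1)"
      using Suc.prems(2) assms(1) by (simp add: prime_dvd_mult_iff del: of_nat_Suc)
    then have IH: "m < card {i. \<not> p dvd coeff ([:1, 1:] ^ m * h) i}"
      using Suc.prems(1) by (intro Suc.IH) auto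
    have "pderiv F = [:1, 1:] ^ Suc m * pderiv g + smult (int (Suc m)) ([:1, 1:] ^ m * g)"
      unfolding F_def by (simp add: pderiv_mult pderiv_power_Suc pderiv_pCons algebra_simps del: power_Suc)
    then have "pCons 0 (pderiv F) - smult (int e) F = [:1, 1:] ^ m * h"
      unfolding F_def h_def
      by (simp add: algebra_simps smult_add_right smult_diff_right)
    then have eq: "[:1, 1:] ^ m * h = pCons 0 (pderiv F) - smult (int e) F" ..
    have "coeff ([:1, 1:] ^ m * h) i = (int i - int e) * coeff F i" for i
      unfolding eq by (cases i) (simp_all add: coeff_pderiv algebra_simps)
    then have "{i. \<not> p dvd coeff ([:1, 1:] ^ m * h) i} \<subseteq> N - {e}"
      by (auto simp: N_def)
    then show ?thesis
      using IH finN card_mono[of "N - {e}"] by (meson finite_Diff less_le_trans)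
  qed
  \<comment> \<open>The choice 0 is arbitrary and only shows that \<open>N\<close> is nonempty;
    removing an actual element \<open>e\<close> of \<open>N\<close> then gains the missing
    1.\<close>
  from step[of 0] obtain e where "e \<in> N"
    by (metis Diff_iff card.empty equals0I not_less_zero)
  then show ?case
    using step[of e] finN by (simp add: N_def F_def)
qed

text \<open>The weights form a divided difference modulo \<open>p\<close>, built one node at a time:
  differences of distinct residues are invertible, and dividing \<open>x^i - z^i\<close> by
  \<open>x - z\<close> lowers the degree in \<open>x\<close> by one.\<close>

lemma interpolation_weights:
  fixes p :: int and A :: "int set"
  assumes "prime p" and "A \<subseteq> {0..<p}" and "card A = Suc a"
  shows "\<exists>u c. \<not> p dvd c \<and> (\<forall>i\<le>a. [(\<Sum>x\<in>A. u x * x ^ i) = (if i = a then c else 0)] (mod p))"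
  using assms(2,3)
proof (induction a arbitrary: A)
  case 0
  then obtain x where "A = {x}"
    by (metis One_nat_def card_1_singletonE)
  then show ?case
    using not_prime_unit[of p] assms(1) by (intro exI[of _ "\<lambda>_. 1"] exI[of _ 1]) auto
next
  case (Suc a)
  then obtain z A' where A: "A = insert z A'" "z \<notin> A'" "card A' = Suc a"
    by (metis card_Suc_eq)
  then have finA: "finite A'"
    by (metis card.infinite nat.distinct(1))
  obtain u c where c: "\<not> p dvd c"
    and u: "\<And>i. i \<le> a \<Longrightarrow> [(\<Sum>x\<in>A'. u x * x ^ i) = (if i = a then c else 0)] (mod p)"
    using Suc.IH[of A'] Suc.prems(1) A by auto
  have "\<exists>w. [(x - z) * w = 1] (mod p)" if "x \<in> A'" for x
  proof (rule cong_solve_coprime_int)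
    have "x \<in> {0..<p}" "z \<in> {0..<p}" and "x \<noteq> z"
      using that A Suc.prems(1) by auto
    then have "\<bar>x - z\<bar> < p" by auto
    with \<open>x \<noteq> z\<close> have "\<not> p dvd x - z"
      using zdvd_imp_le[of p "\<bar>x - z\<bar>"] by auto
    then show "coprime (x - z) p"
      using assms(1) by (metis coprime_commute prime_imp_coprime)
  qed
  then obtain w where w: "\<And>x. x \<in> A' \<Longrightarrow> [(x - z) * w x = 1] (mod p)"
    by metis
  \<comment> \<open>The weight at the new node \<open>z\<close> makes the total weight zero, so
    \<open>x^i\<close> may be replaced by \<open>x^i - z^i\<close>.\<close>
  define v where "v = (\<lambda>x. if x = z then - (\<Sum>y\<in>A'. u y * w y) else u x * w x)"
  have moment: "(\<Sum>x\<in>A. v x * x ^ i) = (\<Sum>x\<in>A'. u x * w x * (x ^ i - z ^ i))" for i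
  proof -
    have "(\<Sum>x\<in>A'. v x * x ^ i) = (\<Sum>x\<in>A'. u x * w x * x ^ i)"
      using A(2) by (intro sum.cong) (auto simp: v_def)
    then show ?thesis
      using A finA by (simp add: v_def right_diff_distrib sum_subtractf sum_distrib_right)
  qed
  have "[(\<Sum>x\<in>A. v x * x ^ i) = (if i = Suc a then c else 0)] (mod p)" if "i \<le> Suc a" for i
  proof (cases i)
    case 0
    then show ?thesis by (simp only: moment) simp
  next
    case (Suc k)
    have "[u x * w x * (x ^ i - z ^ i) = u x * (\<Sum>j<i. x ^ j * z ^ (k - j))] (mod p)"
      if "x \<in> A'" for x
    proof -
      have "x ^ i - z ^ i = (x - z) * (\<Sum>j<i. x ^ j * z ^ (k - j))"
        using Suc by (simp add: diff_power_eq_sum del: power_Suc sum.lessThan_Suc)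
      then have "u x * w x * (x ^ i - z ^ i) = ((x - z) * w x) * (u x * (\<Sum>j<i. x ^ j * z ^ (k - j)))"
        by (simp add: mult_ac)
      then show ?thesis
        using cong_scalar_right[OF w[OF that], of "u x * (\<Sum>j<i. x ^ j * z ^ (k - j))"]
        by (simp only: mult_1)
    qed
    then have "[(\<Sum>x\<in>A. v x * x ^ i) = (\<Sum>x\<in>A'. u x * (\<Sum>j<i. x ^ j * z ^ (k - j)))] (mod p)"
      unfolding moment by (rule cong_sum)
    also have "(\<Sum>x\<in>A'. u x * (\<Sum>j<i. x ^ j * z ^ (k - j)))
        = (\<Sum>j<i. (\<Sum>x\<in>A'. u x * x ^ j) * z ^ (k - j))"
      by (simp add: sum_distrib_left sum_distrib_right mult.assoc sum.swap[of _ A'])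
    \<comment> \<open>As \<open>j < i \<le> Suc a\<close>, the index \<open>j = a\<close> occurs
      only for \<open>i = Suc a\<close>, where its cofactor is \<open>z^0 = 1\<close>.\<close>
    also have "[\<dots> = (\<Sum>j<i. (if j = a then c else 0) * z ^ (k - j))] (mod p)"
      using that Suc by (intro cong_sum cong_mult u) auto
    also have "(\<Sum>j<i. (if j = a then c else 0) * z ^ (k - j)) = (if i = Suc a then c else 0)"
      using that Suc by (auto simp: if_distrib[of "\<lambda>t. t * _"] cong: if_cong)
    finally show ?thesis .
  qed
  then show ?case
    using c by blast
qed

text \<open>A form of the Combinatorial Nullstellensatz: the functional given by the weights \<open>u\<close> and \<open>v\<close>
  extracts the coefficient of \<open>x\<^sup>a y\<^sup>b\<close> of a product of linear forms of total degree at
  most \<open>a + b\<close>. The top-degree part is dehomogenised by setting \<open>y = 1\<close>.\<close>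

lemma weighted_sum_linear_forms:
  fixes p :: int and u v :: "int \<Rightarrow> int"
  assumes u: "\<And>i. i \<le> a \<Longrightarrow> [(\<Sum>x\<in>A. u x * x ^ i) = (if i = a then c else 0)] (mod p)"
    and v: "\<And>i. i \<le> b \<Longrightarrow> [(\<Sum>y\<in>B. v y * y ^ i) = (if i = b then d else 0)] (mod p)"
    and "finite I" and "j + k + card I \<le> a + b"
  shows "[(\<Sum>x\<in>A. \<Sum>y\<in>B. u x * v y * (x ^ j * y ^ k * (\<Prod>i\<in>I. x + e i * y - g i)))
    = (if j + k + card I = a + b then c * d * coeff (monom 1 j * (\<Prod>i\<in>I. [:e i, 1:])) a else 0)]
    (mod p)"
  using assms(3,4)
proof (induction I arbitrary: j k rule: finite_induct)
  case empty
  let ?U = "\<Sum>x\<in>A. u x * x ^ j" and ?V = "\<Sum>y\<in>B. v y * y ^ k"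
  have "(\<Sum>x\<in>A. \<Sum>y\<in>B. u x * v y * (x ^ j * y ^ k)) = ?U * ?V"
    by (simp add: sum_product mult_ac)
  moreover have "[?U * ?V = (if j = a \<and> k = b then c * d else 0)] (mod p)"
  \<comment> \<open>An exponent that is too small gives a vanishing moment; otherwise
    \<open>j + k \<le> a + b\<close> forces equality in both.\<close>
  proof (cases "j < a \<or> k < b")
    case True
    then show ?thesis
      using u[of j] v[of k] cong_mult[of ?U 0 p ?V ?V] cong_mult[of ?U ?U p ?V 0] by fastforce
  next
    case False
    with empty have "j = a" "k = b" by auto
    then show ?thesis
      using cong_mult[OF u[of a] v[of b]] by simp
  qed
  ultimately show ?case
    using empty by auto
next
  case (insert t I)
  let ?L = "\<lambda>j k. \<Sum>x\<in>A. \<Sum>y\<in>B. u x * v y * (x ^ j * y ^ k * (\<Prod>i\<in>I. x + e i * y - g i))"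
  let ?P = "\<Prod>i\<in>I. [:e i, 1:]"
  let ?top = "\<lambda>j k. if j + k + card I = a + b then c * d * coeff (monom 1 j * ?P) a else 0"
  \<comment> \<open>The factor of \<open>t\<close> is multiplied out. Its constant
    \<open>g t\<close> leaves the total degree below \<open>a + b\<close>, so that term contributes
    zero.\<close>
  have expand: "(\<Sum>x\<in>A. \<Sum>y\<in>B. u x * v y * (x ^ j * y ^ k * (\<Prod>i\<in>insert t I. x + e i * y - g i)))
      = ?L (Suc j) k + e t * ?L j (Suc k) - g t * ?L j k"
    using insert.hyps
    by (simp add: algebra_simps sum.distrib sum_subtractf sum_distrib_left)
  have "[?L (Suc j) k + e t * ?L j (Suc k) - g t * ?L j k
      = ?top (Suc j) k + e t * ?top j (Suc k) - g t * ?top j k] (mod p)"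
    using insert.prems insert.hyps
    by (intro cong_diff cong_add cong_mult cong_refl insert.IH) auto
  moreover have "?top (Suc j) k + e t * ?top j (Suc k) - g t * ?top j k =
    (if j + k + card (insert t I) = a + b
     then c * d * coeff (monom 1 j * (\<Prod>i\<in>insert t I. [:e i, 1:])) a else 0)"
  proof -
    have "monom 1 j * ([:e t, 1:] * ?P) = [:e t, 1:] * (monom 1 j * ?P)"
      by (rule mult.left_commute)
    also have "\<dots> = monom 1 (Suc j) * ?P + smult (e t) (monom 1 j * ?P)"
      by (simp add: monom_Suc)
    finally have "coeff (monom 1 j * ([:e t, 1:] * ?P)) a
        = coeff (monom 1 (Suc j) * ?P) a + e t * coeff (monom 1 j * ?P) a"
      by (simp only: coeff_add coeff_smult)
    moreover have "(\<Prod>i\<in>insert t I. [:e i, 1:]) = [:e t, 1:] * ?P"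
      and "card (insert t I) = Suc (card I)"
      using insert.hyps by simp_all
    ultimately show ?thesis
      using insert.prems by (simp only: distrib_left) auto
  qed
  ultimately show ?case
    by (simp only: expand)
qed

text \<open>A window reaching index 0 or the degree \<open>m + s\<close> contains an end
  coefficient, which is 1 or -1. Otherwise all its \<open>s + 1\<close> indices lie in
  \<open>{..m + s}\<close>, leaving only \<open>m\<close> others, too few for the nonzero
  coefficients.\<close>

lemma ex_coeff_not_dvd_in_window:
  fixes p s m a b :: nat
  assumes "prime p" and "m < p" and "a + b = m + 2 * s" and "a < p" and "b < p"
  shows "\<exists>i\<le>a. a \<le> i + s \<and> \<not> int p dvd coeff ([:1, 1:] ^ m * [:- 1, 1:] ^ s) i"
proof -
  define F :: "int poly" where "F = [:1, 1:] ^ m * [:- 1, 1:] ^ s"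
  have p1: "\<not> int p dvd 1" "\<not> int p dvd (- 1) ^ s"
    using assms(1) by (auto simp: prime_nat_iff minus_one_power_iff)
  have deg: "degree F = m + s"
    unfolding F_def by (simp add: degree_mult_eq degree_power_eq)
  consider "a \<le> s" | "b \<le> s" | "s < a" "s < b" by linarith
  then show ?thesis
  proof cases
    case 1
    have "coeff F 0 = (- 1) ^ s"
      by (simp add: F_def coeff_mult_0 coeff_0_power)
    with 1 p1 show ?thesis
      by (intro exI[of _ 0]) (simp add: F_def)
  next
    case 2
    have "lead_coeff F = 1"
      by (simp add: F_def lead_coeff_mult lead_coeff_power)
    with 2 p1 deg assms(3) show ?thesis
      by (intro exI[of _ "m + s"]) (simp add: F_def)
  next
    case 3
    have "\<not> int p dvd poly ([:- 1, 1:] ^ s) (- 1)"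
    proof (cases "s = 0")
      case False
      \<comment> \<open>The value at -1 is \<open>(-2)^s\<close>, so \<open>p = 2\<close> must be
        excluded; this follows from \<open>0 < s < a < p\<close>.\<close>
      with 3 assms(4) have "2 < p" by linarith
      then have "\<not> int p dvd - 2"
        by (auto dest: zdvd_imp_le)
      then show ?thesis
        using assms(1) prime_dvd_power[of "int p" "- 2" s] by auto
    qed (use p1 in simp)
    then have "m < card {i. \<not> int p dvd coeff F i}"
      unfolding F_def using assms by (intro card_coeffs_not_dvd_gt) auto
    moreover have "card ({..m + s} - {a - s..a}) = m"
      using 3 assms(3) by (subst card_Diff_subset) auto
    ultimately have "card ({..m + s} - {a - s..a}) < card {i. \<not> int p dvd coeff F i}"
      by simp
    then have "\<not> {i. \<not> int p dvd coeff F i} \<subseteq> {..m + s} - {a - s..a}"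
      using card_mono[of "{..m + s} - {a - s..a}" "{i. \<not> int p dvd coeff F i}"]
      by (meson finite_Diff finite_atMost leD)
    moreover have "{i. \<not> int p dvd coeff F i} \<subseteq> {..m + s}"
    proof
      fix i assume "i \<in> {i. \<not> int p dvd coeff F i}"
      then have "coeff F i \<noteq> 0" by auto
      then show "i \<in> {..m + s}" using le_degree[of F i] deg by simp
    qed
    ultimately obtain i where "\<not> int p dvd coeff F i" "i \<in> {a - s..a}" by blast
    then show ?thesis
      by (intro exI[of _ i]) (auto simp: F_def)
  qed
qed

lemma restricted_sumset_ZMod:
  assumes "n > 1"
  shows "restricted_sumset (ZMod n) A B S =
    {(a + b) mod int n | a b. a \<in> A \<and> b \<in> B \<and> (a - b) mod int n \<notin> S}"
proof -
  interpret residues "int n" "ZMod n"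
    using assms by unfold_locales auto
  show ?thesis
    unfolding restricted_sumset_def a_minus_def res_add_eq res_neg_eq
    by (simp add: mod_simps)
qed

theorem theorem2:
  fixes p :: nat and A B S C :: "int set"
  assumes "prime p"
    and "A \<subseteq> carrier (ZMod p)" and "A \<noteq> {}"
    and "B \<subseteq> carrier (ZMod p)" and "B \<noteq> {}"
    and "S \<subseteq> carrier (ZMod p)"
    and "C = restricted_sumset (ZMod p) A B S"
  shows "int (card C) \<ge> min (int p) (int (card A) + int (card B) - 2 * int (card S) - 1)"
proof (rule ccontr)
  assume "\<not> ?thesis"
  then have Cp: "card C < p" and Csmall: "card C + 2 * card S + 2 \<le> card A + card B"
    by auto
  have p1: "p > 1" using assms(1) by (rule prime_gt_1_nat)
  have carrier: "carrier (ZMod p) = {0..<int p}"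
    by (auto simp: residue_ring_def)
  note sub = assms(2,4,6)[unfolded carrier]
  have C: "C = {(x + y) mod int p | x y. x \<in> A \<and> y \<in> B \<and> (x - y) mod int p \<notin> S}"
    using assms(7) restricted_sumset_ZMod[OF p1] by simp
  have fin: "finite A" "finite B" "finite S"
    using sub by (auto intro: finite_subset)
  have "C \<subseteq> {0..<int p}"
    using p1 by (auto simp: C)
  then have finC: "finite C" by (rule finite_subset) simp
  have cards: "card A > 0" "card B > 0" "card A \<le> p" "card B \<le> p"
    using fin assms(3,5) card_mono[OF _ sub(1)] card_mono[OF _ sub(2)] by (auto simp: card_gt_0_iff)
  \<comment> \<open>The cap keeps the subtraction defining \<open>b\<close> exact;
    \<open>Csmall\<close> then gives \<open>b < card B\<close>.\<close>
  define a where "a = min (card A - 1) (card C + 2 * card S)"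
  define b where "b = card C + 2 * card S - a"
  have ab: "a + b = card C + 2 * card S" "Suc a \<le> card A" "Suc b \<le> card B"
    using cards Csmall by (auto simp: a_def b_def)
  obtain A' where A': "A' \<subseteq> A" "card A' = Suc a"
    using ab(2) by (metis obtain_subset_with_card_n)
  obtain B' where B': "B' \<subseteq> B" "card B' = Suc b"
    using ab(3) by (metis obtain_subset_with_card_n)
  have prime: "prime (int p)" using assms(1) by simp
  obtain u c where u: "\<not> int p dvd c"
      "\<And>i. i \<le> a \<Longrightarrow> [(\<Sum>x\<in>A'. u x * x ^ i) = (if i = a then c else 0)] (mod int p)"
    using interpolation_weights[OF prime, of A' a] A' sub by blast
  obtain v d where v: "\<not> int p dvd d"
      "\<And>i. i \<le> b \<Longrightarrow> [(\<Sum>y\<in>B'. v y * y ^ i) = (if i = b then d else 0)] (mod int p)"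
    using interpolation_weights[OF prime, of B' b] B' sub by blast
  obtain i where i: "i \<le> a" "a \<le> i + card S"
      "\<not> int p dvd coeff ([:1, 1:] ^ card C * [:- 1, 1:] ^ card S) i"
    using ex_coeff_not_dvd_in_window[OF assms(1) Cp ab(1)] ab cards by auto
  \<comment> \<open>Multiplying by \<open>X^j\<close> moves the nonzero coefficient from index
    \<open>i\<close> to \<open>a\<close>; \<open>k\<close> fills the total degree up to
    \<open>a + b\<close>.\<close>
  define j where "j = a - i"
  define k where "k = i + card S - a"
  \<comment> \<open>A disjoint sum, since an element common to \<open>S\<close> and \<open>C\<close>
    must contribute both the factor \<open>x - y - s\<close> and the factor
    \<open>x + y - c\<close>.\<close>
  define I where "I = S <+> C"
  define e :: "int + int \<Rightarrow> int" where "e = case_sum (\<lambda>_. - 1) (\<lambda>_. 1)"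
  define g :: "int + int \<Rightarrow> int" where "g = case_sum id id"
  have I: "finite I" "card I = card S + card C"
    using fin finC by (auto simp: I_def card_Plus)
  have deg: "j + k + card I = a + b"
    using i ab I by (simp add: j_def k_def)
  have "(\<Prod>t\<in>I. [:e t, 1:]) = [:1, 1:] ^ card C * [:- 1, 1:] ^ card S"
    unfolding I_def using fin finC by (simp add: prod.Plus e_def)
  then have "coeff (monom 1 j * (\<Prod>t\<in>I. [:e t, 1:])) a = coeff ([:1, 1:] ^ card C * [:- 1, 1:] ^ card S) i"
    using i by (simp add: coeff_monom_mult j_def)
  then have nz: "\<not> int p dvd c * d * coeff (monom 1 j * (\<Prod>t\<in>I. [:e t, 1:])) a"
    using i(3) u(1) v(1) prime by (simp add: prime_dvd_mult_iff)
  have "int p dvd (\<Prod>t\<in>I. x + e t * y - g t)" if "x \<in> A'" "y \<in> B'" for x y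
  proof -
    have "\<exists>t\<in>I. int p dvd x + e t * y - g t"
    proof (cases "(x - y) mod int p \<in> S")
      case True
      then have "Inl ((x - y) mod int p) \<in> I" by (auto simp: I_def)
      then show ?thesis
        by (rule rev_bexI) (simp add: e_def g_def dvd_minus_mod)
    next
      case False
      then have "Inr ((x + y) mod int p) \<in> I"
        using that A' B' by (auto simp: I_def C)
      then show ?thesis
        by (rule rev_bexI) (simp add: e_def g_def dvd_minus_mod)
    qed
    then show ?thesis
      using I(1) by (meson dvd_prodI dvd_trans)
  qed
  then have "int p dvd (\<Sum>x\<in>A'. \<Sum>y\<in>B'. u x * v y * (x ^ j * y ^ k * (\<Prod>t\<in>I. x + e t * y - g t)))"
    by (intro dvd_sum dvd_mult)
  with weighted_sum_linear_forms[OF u(2) v(2) I(1), of j k e g] deg nz show False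
    by (simp add: cong_dvd_iff)
qed

end
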